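(* A connected graph $G$ with no isolated vertices is $\gamma_{tR}$-ER-critical if and only if there exist an integer $n\geq 1$ and integers $k_1\geq k_2\geq\dots\geq k_n\geq 0$ with $k_i\neq 1$ for all $1\leq i\leq n$ such that $G$ is isomorphic to the graph obtained from the star $K_{1,n}$ by attaching $k_i$ new pendant vertices to the $i$-th leaf of the star, for each $1\leq i\leq n$.
   Context: All graphs are finite and simple. A total Roman dominating function (TRD-function) on a graph $G$ with no isolated vertices is a function $f:V(G)\to\{0,1,2\}$ such that every vertex $v$ with $f(v)=0$ is adjacent to some $u$ with $f(u)=2$, and the subgraph induced by $\{w:f(w)>0\}$ has no isolated vertices; its weight is $\sum_v f(v)$ and $\gamma_{tR}(G)$ is the minimum weight. For an edge $e$ incident with a vertex of degree $1$, define $\gamma_{tR}(G-e)=\infty$. A graph $G$ with no isolated vertices is $\gamma_{tR}$-ER-critical if $\gamma_{tR}(G-e)>\gamma_{tR}(G)$ for every edge $e\in E(G)$. (When $n=1$, either vertex of $K_{1,1}$ may be regarded as the centre.) *)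

theory Defs
  imports "Graph_Theory.Graph_Theory" "HOL-Library.Extended_Nat"
begin

text \<open>
  A finite simple graph is a \<^locale>\<open>pair_graph\<close>: a finite, loop-free, symmetric digraph
  whose arcs are pairs of vertices. An undirected edge \<open>uv\<close> is the pair of arcs
  \<open>(u, v)\<close>, \<open>(v, u)\<close>, and the degree of a vertex is its \<^const>\<open>out_degree\<close>.
\<close>

definition no_isolated_verts :: "('a, 'b) pre_digraph \<Rightarrow> bool" where
  "no_isolated_verts G \<longleftrightarrow> (\<forall>v \<in> verts G. \<exists>u \<in> verts G. v \<rightarrow>\<^bsub>G\<^esub> u)"

definition del_edge :: "'a pair_pre_digraph \<Rightarrow> 'a \<Rightarrow> 'a \<Rightarrow> 'a pair_pre_digraph" where
  "del_edge G u v = G\<lparr>parcs := parcs G - {(u, v), (v, u)}\<rparr>"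

text \<open>Values of \<open>f\<close> outside the vertex set are irrelevant.\<close>

definition trd_function :: "'a pair_pre_digraph \<Rightarrow> ('a \<Rightarrow> nat) \<Rightarrow> bool" where
  "trd_function G f \<longleftrightarrow>
     f ` pverts G \<subseteq> {0, 1, 2} \<and>
     (\<forall>v \<in> pverts G. f v = 0 \<longrightarrow> (\<exists>u \<in> pverts G. v \<rightarrow>\<^bsub>G\<^esub> u \<and> f u = 2)) \<and>
     no_isolated_verts (G \<restriction> {w \<in> pverts G. f w > 0})"

definition trd_weight :: "'a pair_pre_digraph \<Rightarrow> ('a \<Rightarrow> nat) \<Rightarrow> nat" where
  "trd_weight G f = (\<Sum>v \<in> pverts G. f v)"

text \<open>Only meaningful for graphs without isolated vertices: the others have no TRD-function.\<close>

definition gamma_tR :: "'a pair_pre_digraph \<Rightarrow> nat" where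
  "gamma_tR G = Min {trd_weight G f | f. trd_function G f}"

definition gamma_tR_del :: "'a pair_pre_digraph \<Rightarrow> 'a \<Rightarrow> 'a \<Rightarrow> enat" where
  "gamma_tR_del G u v =
     (if out_degree G u = 1 \<or> out_degree G v = 1 then \<infinity> else enat (gamma_tR (del_edge G u v)))"

definition gamma_tR_ER_critical :: "'a pair_pre_digraph \<Rightarrow> bool" where
  "gamma_tR_ER_critical G \<longleftrightarrow>
     no_isolated_verts G \<and> (\<forall>(u, v) \<in> parcs G. gamma_tR_del G u v > enat (gamma_tR G))"

datatype star_vert = Centre | Leaf nat | Pendant nat nat

definition star :: "nat \<Rightarrow> star_vert pair_pre_digraph" where
  "star n =
     \<lparr>pverts = {Centre} \<union> Leaf ` {1..n},
      parcs = (\<Union>i \<in> {1..n}. {(Centre, Leaf i), (Leaf i, Centre)})\<rparr>"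

text \<open>For each \<open>i\<close> in \<open>{1..n}\<close>, the leaf \<open>Leaf i\<close> receives the pendant vertices
  \<open>Pendant i 1, \<dots>, Pendant i (k i)\<close>.\<close>

definition star_with_pendants :: "nat \<Rightarrow> (nat \<Rightarrow> nat) \<Rightarrow> star_vert pair_pre_digraph" where
  "star_with_pendants n k =
     \<lparr>pverts = pverts (star n) \<union> (\<Union>i \<in> {1..n}. Pendant i ` {1..k i}),
      parcs = parcs (star n) \<union>
        (\<Union>i \<in> {1..n}. \<Union>j \<in> {1..k i}. {(Leaf i, Pendant i j), (Pendant i j, Leaf i)})\<rparr>"

lemma pair_graph_star: "pair_graph (star n)"
  by unfold_locales (auto simp: star_def symmetric_def sym_def)

lemma pair_graph_star_with_pendants: "pair_graph (star_with_pendants n k)"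
  by unfold_locales
    (auto simp: star_with_pendants_def star_def symmetric_def sym_def image_iff Bex_def)

end

theory Submission
  imports Defs
begin

text \<open>
  Necessity: among the TRD-functions of minimum weight choose \<open>f\<close> with as few zeros as possible.
  No edge is superfluous for \<open>f\<close>, so every vertex of value \<open>0\<close> is a pendant vertex and the positive
  vertices induce a star forest, which by connectedness is a single star. If a leaf \<open>l\<close> of that
  star had exactly one pendant vertex \<open>p\<close>, then the values \<open>2\<close> at \<open>l\<close> and \<open>0\<close> at \<open>p\<close> could be
  replaced by \<open>1\<close> and \<open>1\<close>, leaving fewer zeros.

  Sufficiency: only an edge \<open>cl\<close> from the centre \<open>c\<close> to a leaf \<open>l\<close> with at least two pendant
  vertices can be deleted without creating an isolated vertex. If \<open>s\<close> leaves have pendant vertices,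
  then the value \<open>2\<close> at each of them, together with \<open>1\<close> or \<open>2\<close> at \<open>c\<close>, gives a TRD-function of
  weight \<open>2s + 1\<close> or \<open>2s + 2\<close>. Without \<open>cl\<close>, the leaf \<open>l\<close> and its pendant vertices alone have
  weight at least \<open>3\<close>, and the rest of the tree cannot compensate for this.
\<close>

section \<open>Neighbourhoods\<close>

definition nbrs :: "'a pair_pre_digraph \<Rightarrow> 'a \<Rightarrow> 'a set" where
  "nbrs G v = parcs G `` {v}"

lemma in_nbrs_iff: "w \<in> nbrs G v \<longleftrightarrow> (v, w) \<in> parcs G"
  by (simp add: nbrs_def)

lemma (in pair_wf_digraph) nbrs_subset_verts: "nbrs G v \<subseteq> pverts G"
  by (auto simp: in_nbrs_iff dest: in_arcsD2)

lemma (in pair_wf_digraph) parcs_eq_Sigma_nbrs: "parcs G = (SIGMA v:pverts G. nbrs G v)"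
  using in_arcsD1 by (auto simp: nbrs_def)

lemma (in pair_wf_digraph) no_isolated_verts_iff:
  "no_isolated_verts G \<longleftrightarrow> (\<forall>v \<in> pverts G. nbrs G v \<noteq> {})"
proof -
  have "(\<exists>u \<in> pverts G. (v, u) \<in> parcs G) \<longleftrightarrow> nbrs G v \<noteq> {}" for v
    using in_arcsD2 by (auto simp: nbrs_def)
  then show ?thesis
    by (simp add: no_isolated_verts_def)
qed

lemma (in pair_fin_digraph) finite_nbrs [simp]: "finite (nbrs G v)"
  using nbrs_subset_verts pair_finite_verts by (rule finite_subset)

lemma (in pair_fin_digraph) out_degree_eq_card_nbrs: "out_degree G v = card (nbrs G v)"
proof -
  have "out_arcs G v = Pair v ` nbrs G v"
    by (auto simp: out_arcs_def in_nbrs_iff)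
  then show ?thesis
    by (simp add: out_degree_def card_image inj_on_def)
qed

lemma (in pair_fin_digraph) out_degree_eq_1_iff:
  assumes "v \<in> nbrs G u"
  shows "out_degree G u = 1 \<longleftrightarrow> nbrs G u = {v}"
  using assms by (auto simp: out_degree_eq_card_nbrs card_1_singleton_iff)

lemma (in pair_sym_digraph) nbrs_sym: "u \<in> nbrs G v \<longleftrightarrow> v \<in> nbrs G u"
  using arcs_symmetric by (auto simp: in_nbrs_iff)

lemma (in pair_wf_digraph) in_nbrsD:
  assumes "u \<in> nbrs G v"
  shows "u \<in> pverts G" "v \<in> pverts G"
  using assms in_arcsD1 in_arcsD2 by (auto simp: in_nbrs_iff)

lemma (in pair_loopfree_digraph) not_in_nbrs_self: "v \<notin> nbrs G v"
  using no_loops' by (auto simp: in_nbrs_iff)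

lemma (in pair_sym_digraph) connected_verts_subset_closed:
  assumes "connected G" "c \<in> pverts G" "c \<in> A"
    and closed: "\<And>v. v \<in> A \<Longrightarrow> nbrs G v \<subseteq> A"
  shows "pverts G \<subseteq> A"
proof
  fix v assume "v \<in> pverts G"
  moreover have "strongly_connected G"
    using symmetric_connected_imp_strongly_connected[OF pair_sym_arcs assms(1)] .
  ultimately have "c \<rightarrow>\<^sup>*\<^bsub>G\<^esub> v"
    using assms(2) by (simp add: strongly_connected_def)
  then show "v \<in> A"
  proof (induction rule: reachable_induct)
    case base
    show ?case by fact
  next
    case (step x y)
    then have "y \<in> nbrs G x"
      by (simp add: in_nbrs_iff)
    with closed[OF step.IH] show ?case by blast
  qed
qed

lemma pverts_del_edge [simp]: "pverts (del_edge G u v) = pverts G"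
  by (simp add: del_edge_def)

lemma in_nbrs_del_edge_iff:
  "y \<in> nbrs (del_edge G u v) x \<longleftrightarrow> y \<in> nbrs G x \<and> (x, y) \<noteq> (u, v) \<and> (x, y) \<noteq> (v, u)"
  by (auto simp: in_nbrs_iff del_edge_def)

lemma del_edge_commute: "del_edge G u v = del_edge G v u"
  by (simp add: del_edge_def insert_commute)

lemma (in pair_graph) pair_graph_del_edge: "pair_graph (del_edge G u v)"
proof
  show "symmetric (del_edge G u v)"
    by (auto simp: symmetric_def del_edge_def intro!: symI dest: arcs_symmetric)
qed (auto simp: del_edge_def pair_finite_verts pair_finite_arcs
      dest: arc_fst_in_verts arc_snd_in_verts pair_no_loops)

lemma (in pair_graph) no_isolated_verts_del_edge_iff:
  assumes "no_isolated_verts G" "v \<in> nbrs G u"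
  shows "no_isolated_verts (del_edge G u v) \<longleftrightarrow> out_degree G u \<noteq> 1 \<and> out_degree G v \<noteq> 1"
proof -
  interpret D: pair_graph "del_edge G u v"
    by (rule pair_graph_del_edge)
  have uv: "u \<in> nbrs G v" "u \<in> pverts G" "v \<in> pverts G" "u \<noteq> v"
    using assms(2) nbrs_sym in_nbrsD not_in_nbrs_self by blast+
  have "nbrs (del_edge G u v) x = (if x = u then nbrs G u - {v}
      else if x = v then nbrs G v - {u} else nbrs G x)" for x
    using uv by (auto simp: in_nbrs_del_edge_iff)
  moreover have "nbrs G x - {y} = {} \<longleftrightarrow> nbrs G x = {y}" if "y \<in> nbrs G x" for x y
    using that by blast
  ultimately show ?thesis
    using assms uv out_degree_eq_1_iff
    by (simp add: no_isolated_verts_iff D.no_isolated_verts_iff) metis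
qed


section \<open>Isomorphisms of graphs without parallel arcs\<close>

lemma digraph_iso_iff_map_prod:
  fixes G :: "'a pair_pre_digraph" and H :: "'b pair_pre_digraph"
  assumes "pair_wf_digraph G"
  shows "digraph_iso G H \<longleftrightarrow>
    (\<exists>\<phi>. bij_betw \<phi> (pverts G) (pverts H) \<and> parcs H = map_prod \<phi> \<phi> ` parcs G)"
proof
  assume "digraph_iso G H"
  then obtain h where h: "pre_digraph.digraph_isomorphism G h" and H: "with_proj H = app_iso h G"
    unfolding digraph_iso_def by blast
  have proj: "iso_tail h = fst" "iso_head h = snd"
    using arg_cong[OF H, of tail] arg_cong[OF H, of head] by simp_all
  have "iso_arcs h e = map_prod (iso_verts h) (iso_verts h) e" if "e \<in> parcs G" for e
    using h that unfolding pre_digraph.digraph_isomorphism_def proj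
    by (auto simp: prod_eq_iff)
  then have "iso_arcs h ` parcs G = map_prod (iso_verts h) (iso_verts h) ` parcs G"
    by (intro image_cong) auto
  then show "\<exists>\<phi>. bij_betw \<phi> (pverts G) (pverts H) \<and> parcs H = map_prod \<phi> \<phi> ` parcs G"
    using h arg_cong[OF H, of verts] arg_cong[OF H, of arcs]
    unfolding pre_digraph.digraph_isomorphism_def bij_betw_def by auto
next
  assume "\<exists>\<phi>. bij_betw \<phi> (pverts G) (pverts H) \<and> parcs H = map_prod \<phi> \<phi> ` parcs G"
  then obtain \<phi> where \<phi>: "inj_on \<phi> (pverts G)" "pverts H = \<phi> ` pverts G"
    "parcs H = map_prod \<phi> \<phi> ` parcs G"
    unfolding bij_betw_def by blast
  define h where
    "h = \<lparr>iso_verts = \<phi>, iso_arcs = map_prod \<phi> \<phi>, iso_head = snd, iso_tail = fst\<rparr>"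
  have "parcs G \<subseteq> pverts G \<times> pverts G"
    using assms by (auto dest: pair_wf_digraph.in_arcsD1 pair_wf_digraph.in_arcsD2)
  then have "inj_on (map_prod \<phi> \<phi>) (parcs G)"
    using map_prod_inj_on[OF \<phi>(1) \<phi>(1)] by (rule inj_on_subset[rotated])
  then have "pre_digraph.digraph_isomorphism G h"
    unfolding pre_digraph.digraph_isomorphism_def
    using \<phi>(1) assms by (auto simp: h_def wf_digraph_wp_iff)
  moreover have "with_proj H = app_iso h G"
    using \<phi>(2,3) by (simp add: h_def app_iso_def with_proj_def)
  ultimately show "digraph_iso G H"
    unfolding digraph_iso_def by blast
qed

lemma digraph_iso_iff_nbrs:
  fixes G :: "'a pair_pre_digraph" and H :: "'b pair_pre_digraph"
  assumes "pair_wf_digraph G" "pair_wf_digraph H"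
  shows "digraph_iso G H \<longleftrightarrow>
    (\<exists>\<phi>. bij_betw \<phi> (pverts G) (pverts H) \<and> (\<forall>v \<in> pverts G. nbrs H (\<phi> v) = \<phi> ` nbrs G v))"
proof -
  interpret G: pair_wf_digraph G by fact
  interpret H: pair_wf_digraph H by fact
  have "parcs H = map_prod \<phi> \<phi> ` parcs G \<longleftrightarrow> (\<forall>v \<in> pverts G. nbrs H (\<phi> v) = \<phi> ` nbrs G v)"
    (is "?arcs \<longleftrightarrow> ?nbrs") if bij: "bij_betw \<phi> (pverts G) (pverts H)" for \<phi>
  proof
    assume arcs: ?arcs
    show ?nbrs
    proof
      fix v assume "v \<in> pverts G"
      then have "\<phi> x = \<phi> v \<longleftrightarrow> x = v" if "(x, y) \<in> parcs G" for x y
        using inj_on_eq_iff[OF bij_betw_imp_inj_on[OF bij]] G.in_arcsD1[OF that] by blast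
      moreover have "nbrs H (\<phi> v) = {\<phi> y | x y. (x, y) \<in> parcs G \<and> \<phi> x = \<phi> v}"
        unfolding nbrs_def arcs by force
      ultimately show "nbrs H (\<phi> v) = \<phi> ` nbrs G v"
        unfolding nbrs_def by blast
    qed
  next
    assume nbrs: ?nbrs
    have "parcs H = (SIGMA w:\<phi> ` pverts G. nbrs H w)"
      unfolding bij_betw_imp_surj_on[OF bij] by (rule H.parcs_eq_Sigma_nbrs)
    also have "\<dots> = (\<Union>v \<in> pverts G. {\<phi> v} \<times> \<phi> ` nbrs G v)"
      using nbrs by auto
    also have "\<dots> = map_prod \<phi> \<phi> ` parcs G"
      unfolding G.parcs_eq_Sigma_nbrs by auto
    finally show ?arcs .
  qed
  then show ?thesis
    unfolding digraph_iso_iff_map_prod[OF assms(1)] by (intro ex_cong1 conj_cong refl)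
qed


section \<open>Total Roman dominating functions\<close>

definition defenders :: "'a pair_pre_digraph \<Rightarrow> ('a \<Rightarrow> nat) \<Rightarrow> 'a \<Rightarrow> 'a set" where
  "defenders G f v = {u \<in> nbrs G v. if f v = 0 then f u = 2 else f u > 0}"

lemma in_defendersD:
  assumes "u \<in> defenders G f v"
  shows "u \<in> nbrs G v" "f u > 0"
  using assms by (auto simp: defenders_def split: if_splits)

lemma (in pair_fin_digraph) finite_defenders [simp]: "finite (defenders G f v)"
  by (simp add: defenders_def)

lemma (in pair_wf_digraph) trd_function_iff:
  "trd_function G f \<longleftrightarrow> (\<forall>v \<in> pverts G. f v \<le> 2) \<and> (\<forall>v \<in> pverts G. defenders G f v \<noteq> {})"
proof -
  have range: "x \<in> {0, 1, 2} \<longleftrightarrow> x \<le> 2" for x :: nat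
    by auto
  have "v \<rightarrow>\<^bsub>G \<restriction> S\<^esub> u \<longleftrightarrow> (v, u) \<in> parcs G \<and> v \<in> S \<and> u \<in> S" for S v u
    by (auto simp: arcs_ends_conv)
  then have positive: "no_isolated_verts (G \<restriction> {w \<in> pverts G. f w > 0}) \<longleftrightarrow>
      (\<forall>v \<in> pverts G. f v > 0 \<longrightarrow> (\<exists>u \<in> pverts G. (v, u) \<in> parcs G \<and> f u > 0))"
    unfolding no_isolated_verts_def induce_subgraph_verts by blast
  have "defenders G f v \<noteq> {} \<longleftrightarrow>
      (f v = 0 \<longrightarrow> (\<exists>u \<in> pverts G. (v, u) \<in> parcs G \<and> f u = 2)) \<and>
      (f v > 0 \<longrightarrow> (\<exists>u \<in> pverts G. (v, u) \<in> parcs G \<and> f u > 0))" for v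
    using in_arcsD2 by (auto simp: defenders_def nbrs_def)
  then show ?thesis
    unfolding trd_function_def image_subset_iff range positive with_proj_simps
    by (simp only: ball_conj_distrib)
qed

lemma (in pair_wf_digraph) ex_defender:
  assumes "trd_function G f" "v \<in> pverts G"
  shows "\<exists>u. u \<in> defenders G f v"
  using assms by (simp add: trd_function_iff ex_in_conv)

lemma (in pair_wf_digraph) trd_function_imp_ex_positive:
  assumes "trd_function G f" "pverts G \<noteq> {}"
  shows "\<exists>v \<in> pverts G. f v > 0"
proof -
  obtain v u where "u \<in> defenders G f v"
    using assms ex_defender by blast
  then show ?thesis
    using in_defendersD nbrs_subset_verts by (metis subsetD)
qed

lemma (in pair_wf_digraph) trd_function_imp_no_isolated_verts:
  assumes "trd_function G f"
  shows "no_isolated_verts G"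
  using assms by (auto simp: trd_function_iff no_isolated_verts_iff defenders_def)

lemma (in pair_wf_digraph) defenders_pendant:
  assumes "trd_function G f" "v \<in> pverts G" "nbrs G v = {w}"
  shows "defenders G f v = {w}"
proof -
  have "defenders G f v \<noteq> {}" "defenders G f v \<subseteq> nbrs G v"
    using assms(1,2) by (auto simp: trd_function_iff defenders_def)
  then show ?thesis
    using assms(3) by (simp add: subset_singleton_iff)
qed

lemma (in pair_wf_digraph) trd_function_pendant_ge:
  assumes "trd_function G f" "v \<in> pverts G" "nbrs G v = {w}"
  shows "2 \<le> f v + f w"
proof -
  have "w \<in> defenders G f v"
    using defenders_pendant[OF assms] by simp
  then show ?thesis
    by (auto simp: defenders_def split: if_splits)
qed

lemma (in pair_fin_digraph) trd_function_star_ge: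
  assumes f: "trd_function G f" and "v \<in> pverts G" "2 \<le> card (nbrs G v)"
    and pendant: "\<And>w. w \<in> nbrs G v \<Longrightarrow> nbrs G w = {v}"
  shows "3 \<le> f v + sum f (nbrs G v)"
proof (cases "f v = 2")
  case True
  obtain w where "w \<in> defenders G f v"
    using ex_defender[OF f assms(2)] by blast
  then have "w \<in> nbrs G v" "f w > 0"
    using True by (simp_all add: defenders_def)
  then have "0 < sum f (nbrs G v)"
    by (auto simp: sum_pos2)
  with True show ?thesis by simp
next
  case False
  have "0 < f w \<and> 0 < f v" if w: "w \<in> nbrs G v" for w
  proof -
    have "v \<in> defenders G f w"
      using defenders_pendant[OF f _ pendant[OF w]] nbrs_subset_verts w by blast
    then show ?thesis
      using False by (auto simp: defenders_def split: if_splits)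
  qed
  moreover from this have "card (nbrs G v) \<le> sum f (nbrs G v)"
    using sum_mono[of "nbrs G v" "\<lambda>_. 1" f] by (simp add: Suc_le_eq)
  moreover have "nbrs G v \<noteq> {}"
    using assms(3) by auto
  ultimately have "0 < f v" "2 \<le> sum f (nbrs G v)"
    using assms(3) by auto
  then show ?thesis by linarith
qed

lemma (in pair_fin_digraph) finite_trd_weights: "finite {trd_weight G f | f. trd_function G f}"
proof (rule finite_subset)
  show "{trd_weight G f | f. trd_function G f} \<subseteq> {..card (pverts G) * 2}"
    using sum_bounded_above[of "pverts G" _ "2 :: nat"]
    by (auto simp: trd_weight_def trd_function_iff)
qed simp

lemma (in pair_fin_digraph) gamma_tR_le:
  assumes "trd_function G f"
  shows "gamma_tR G \<le> trd_weight G f"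
  unfolding gamma_tR_def using assms finite_trd_weights by (intro Min_le) auto

lemma (in pair_fin_digraph) gamma_tR_attained:
  assumes "no_isolated_verts G"
  obtains f where "trd_function G f" "trd_weight G f = gamma_tR G"
proof -
  have "trd_function G (\<lambda>_. 1)"
    using assms by (auto simp: trd_function_iff no_isolated_verts_iff defenders_def)
  then have "{trd_weight G f | f. trd_function G f} \<noteq> {}"
    by blast
  then have "gamma_tR G \<in> {trd_weight G f | f. trd_function G f}"
    unfolding gamma_tR_def using finite_trd_weights by (rule Min_in[rotated])
  then show thesis
    using that by auto
qed

lemma trd_weight_del_edge [simp]: "trd_weight (del_edge G u v) f = trd_weight G f"
  by (simp add: trd_weight_def)

lemma (in pair_graph) less_gamma_tR_del_iff:
  assumes "no_isolated_verts G" "v \<in> nbrs G u"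
  shows "enat m < gamma_tR_del G u v \<longleftrightarrow>
    (\<forall>f. trd_function (del_edge G u v) f \<longrightarrow> m < trd_weight G f)"
proof -
  interpret D: pair_graph "del_edge G u v"
    by (rule pair_graph_del_edge)
  note degrees = no_isolated_verts_del_edge_iff[OF assms]
  show ?thesis
  proof (cases "no_isolated_verts (del_edge G u v)")
    case True
    then have "gamma_tR_del G u v = gamma_tR (del_edge G u v)"
      using degrees by (simp add: gamma_tR_del_def)
    moreover obtain g where "trd_function (del_edge G u v) g"
      "trd_weight G g = gamma_tR (del_edge G u v)"
      using D.gamma_tR_attained[OF True] by auto
    ultimately show ?thesis
      using D.gamma_tR_le by (auto intro: less_le_trans)
  next
    case False
    then show ?thesis
      using degrees D.trd_function_imp_no_isolated_verts by (auto simp: gamma_tR_del_def)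
  qed
qed

lemma (in pair_graph) gamma_tR_ER_critical_iff:
  assumes "no_isolated_verts G"
  shows "gamma_tR_ER_critical G \<longleftrightarrow>
    (\<forall>u. \<forall>v \<in> nbrs G u. \<forall>f. trd_function (del_edge G u v) f \<longrightarrow> gamma_tR G < trd_weight G f)"
proof -
  have "gamma_tR_ER_critical G \<longleftrightarrow>
      (\<forall>u. \<forall>v \<in> nbrs G u. enat (gamma_tR G) < gamma_tR_del G u v)"
    using assms by (auto simp: gamma_tR_ER_critical_def in_nbrs_iff)
  then show ?thesis
    using less_gamma_tR_del_iff[OF assms] by simp
qed


section \<open>Two-level trees\<close>

definition pendants :: "'a pair_pre_digraph \<Rightarrow> 'a \<Rightarrow> 'a \<Rightarrow> 'a set" where
  "pendants G c l = nbrs G l - {c}"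

definition pendant_counts :: "'a pair_pre_digraph \<Rightarrow> 'a \<Rightarrow> nat set" where
  "pendant_counts G c = (\<lambda>l. card (pendants G c l)) ` nbrs G c"

locale two_level_tree = pair_graph G for G :: "'a pair_pre_digraph" +
  fixes c :: 'a
  assumes pverts_eq: "pverts G = insert c (\<Union>l \<in> nbrs G c. insert l (pendants G c l))"
    and nbrs_centre_nonempty: "nbrs G c \<noteq> {}"
    and nbrs_pendant: "\<lbrakk>l \<in> nbrs G c; q \<in> pendants G c l\<rbrakk> \<Longrightarrow> nbrs G q = {l}"
begin

lemma centre_in_verts: "c \<in> pverts G"
  by (simp add: pverts_eq)

lemma leaf_neq_centre: "l \<in> nbrs G c \<Longrightarrow> l \<noteq> c"
  using not_in_nbrs_self by blast

lemma nbrs_leaf: "l \<in> nbrs G c \<Longrightarrow> nbrs G l = insert c (pendants G c l)"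
  using nbrs_sym by (auto simp: pendants_def)

lemma pendant_neq_centre: "q \<in> pendants G c l \<Longrightarrow> q \<noteq> c"
  by (simp add: pendants_def)

lemma pendant_not_leaf:
  assumes "l \<in> nbrs G c" "q \<in> pendants G c l"
  shows "q \<notin> nbrs G c"
  using nbrs_pendant[OF assms] leaf_neq_centre[OF assms(1)] nbrs_sym[of q c] by auto

lemma pendants_subset_verts: "pendants G c l \<subseteq> pverts G"
  using nbrs_subset_verts by (auto simp: pendants_def)

lemma finite_pendants [simp]: "finite (pendants G c l)"
  by (simp add: pendants_def)

lemma disjoint_branches: "disjoint_family_on (\<lambda>l. insert l (pendants G c l)) (nbrs G c)"
  unfolding disjoint_family_on_def
proof (intro ballI impI)
  fix l m assume lm: "l \<in> nbrs G c" "m \<in> nbrs G c" "l \<noteq> m"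
  then have "pendants G c l \<inter> pendants G c m = {}"
    using nbrs_pendant by blast
  then show "insert l (pendants G c l) \<inter> insert m (pendants G c m) = {}"
    using lm pendant_not_leaf by blast
qed

lemma centre_not_in_branches: "c \<notin> (\<Union>l \<in> nbrs G c. insert l (pendants G c l))"
  using leaf_neq_centre pendant_neq_centre by blast

lemma vert_cases:
  assumes "v \<in> pverts G"
  obtains (centre) "v = c" | (leaf) "v \<in> nbrs G c"
    | (pendant) l where "l \<in> nbrs G c" "v \<in> pendants G c l"
  using assms unfolding pverts_eq by blast

definition branch_weight :: "('a \<Rightarrow> nat) \<Rightarrow> 'a \<Rightarrow> nat" where
  "branch_weight f l = f l + sum f (pendants G c l)"

lemma trd_weight_eq: "trd_weight G f = f c + sum (branch_weight f) (nbrs G c)"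
proof -
  have "trd_weight G f = f c + sum f (\<Union>l \<in> nbrs G c. insert l (pendants G c l))"
    using centre_not_in_branches by (simp add: trd_weight_def pverts_eq)
  also have "sum f (\<Union>l \<in> nbrs G c. insert l (pendants G c l)) =
      (\<Sum>l \<in> nbrs G c. sum f (insert l (pendants G c l)))"
    using disjoint_branches by (intro sum.UNION_disjoint) (auto simp: disjoint_family_on_def)
  also have "\<dots> = sum (branch_weight f) (nbrs G c)"
    unfolding branch_weight_def using pendant_not_leaf by (intro sum.cong refl sum.insert) auto
  finally show ?thesis .
qed

lemma branch_weight_ge: "q \<in> pendants G c l \<Longrightarrow> f l + f q \<le> branch_weight f l"
  by (simp add: branch_weight_def member_le_sum)

end

lemma pendants_image:
  fixes G :: "'a pair_pre_digraph" and H :: "'b pair_pre_digraph"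
  assumes "pair_wf_digraph G" and inj: "inj_on \<phi> (pverts G)"
    and nbrs: "nbrs H (\<phi> l) = \<phi> ` nbrs G l" and "c \<in> pverts G"
  shows "pendants H (\<phi> c) (\<phi> l) = \<phi> ` pendants G c l"
proof -
  have "\<phi> ` (nbrs G l - {c}) = \<phi> ` nbrs G l - \<phi> ` {c}"
    using pair_wf_digraph.nbrs_subset_verts[OF assms(1)] assms(4)
    by (intro inj_on_image_set_diff[OF inj]) auto
  then show ?thesis
    by (simp add: pendants_def nbrs)
qed

lemma two_level_tree_image:
  fixes G :: "'a pair_pre_digraph" and H :: "'b pair_pre_digraph"
  assumes "two_level_tree G c" "pair_graph H" and bij: "bij_betw \<phi> (pverts G) (pverts H)"
    and nbrs: "\<And>v. v \<in> pverts G \<Longrightarrow> nbrs H (\<phi> v) = \<phi> ` nbrs G v"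
  shows "two_level_tree H (\<phi> c)" "pendant_counts H (\<phi> c) = pendant_counts G c"
proof -
  interpret G: two_level_tree G c by fact
  interpret H: pair_graph H by fact
  have inj: "inj_on \<phi> (pverts G)"
    using bij by (rule bij_betw_imp_inj_on)
  have leaves: "nbrs H (\<phi> c) = \<phi> ` nbrs G c"
    by (intro nbrs G.centre_in_verts)
  have pendants: "pendants H (\<phi> c) (\<phi> l) = \<phi> ` pendants G c l" if "l \<in> nbrs G c" for l
    using G.in_nbrsD(1)[OF that]
    by (intro pendants_image[OF G.pair_wf_digraph inj] nbrs G.centre_in_verts)
  show "two_level_tree H (\<phi> c)"
  proof
    have "pverts H = \<phi> ` pverts G"
      using bij by (simp add: bij_betw_def)
    also have "\<dots> = insert (\<phi> c) (\<Union>l \<in> nbrs G c. insert (\<phi> l) (\<phi> ` pendants G c l))"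
      unfolding G.pverts_eq by blast
    finally show "pverts H = insert (\<phi> c) (\<Union>l \<in> nbrs H (\<phi> c). insert l (pendants H (\<phi> c) l))"
      by (simp add: leaves pendants)
    show "nbrs H (\<phi> c) \<noteq> {}"
      using G.nbrs_centre_nonempty by (simp add: leaves)
    fix l q assume "l \<in> nbrs H (\<phi> c)" "q \<in> pendants H (\<phi> c) l"
    then obtain l' q' where l': "l' \<in> nbrs G c" "l = \<phi> l'"
      and q': "q' \<in> pendants G c l'" "q = \<phi> q'"
      using pendants by (auto simp: leaves)
    then have "nbrs H q = \<phi> ` nbrs G q'"
      using nbrs[OF subsetD[OF G.pendants_subset_verts q'(1)]] by simp
    then show "nbrs H q = {l}"
      using G.nbrs_pendant[OF l'(1) q'(1)] l'(2) by simp
  qed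
  have "card (pendants H (\<phi> c) (\<phi> l)) = card (pendants G c l)" if "l \<in> nbrs G c" for l
    unfolding pendants[OF that] using inj G.pendants_subset_verts
    by (intro card_image) (rule inj_on_subset)
  then show "pendant_counts H (\<phi> c) = pendant_counts G c"
    by (simp add: pendant_counts_def leaves image_image)
qed

lemma two_level_tree_bij_betw_verts:
  fixes G :: "'a pair_pre_digraph" and H :: "'b pair_pre_digraph"
  assumes "two_level_tree G c" "two_level_tree H (\<phi> c)"
    and leaves: "bij_betw \<phi> (nbrs G c) (nbrs H (\<phi> c))"
    and pendants:
      "\<And>l. l \<in> nbrs G c \<Longrightarrow> bij_betw \<phi> (pendants G c l) (pendants H (\<phi> c) (\<phi> l))"
  shows "bij_betw \<phi> (pverts G) (pverts H)"
proof -
  interpret G: two_level_tree G c by fact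
  interpret H: two_level_tree H "\<phi> c" by fact
  have leaf: "\<phi> l \<in> nbrs H (\<phi> c)" if "l \<in> nbrs G c" for l
    using leaves that by (rule bij_betwE[rule_format])
  have "bij_betw \<phi> (insert l (pendants G c l)) (insert (\<phi> l) (pendants H (\<phi> c) (\<phi> l)))"
    if "l \<in> nbrs G c" for l
    using bij_betw_combine[OF _ pendants[OF that], of "{l}" "{\<phi> l}"]
      H.pendant_not_leaf leaf[OF that] by auto
  moreover have "disjoint_family_on (\<lambda>l. insert (\<phi> l) (pendants H (\<phi> c) (\<phi> l))) (nbrs G c)"
    using H.disjoint_branches leaves leaf unfolding disjoint_family_on_def
    by (metis bij_betw_imp_inj_on inj_onD)
  ultimately have "bij_betw \<phi> (\<Union>l \<in> nbrs G c. insert l (pendants G c l))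
      (\<Union>l \<in> nbrs G c. insert (\<phi> l) (pendants H (\<phi> c) (\<phi> l)))"
    by (intro bij_betw_UNION_disjoint)
  then have "bij_betw \<phi> (\<Union>l \<in> nbrs G c. insert l (pendants G c l))
      (\<Union>l \<in> nbrs H (\<phi> c). insert l (pendants H (\<phi> c) l))"
    by (simp add: bij_betw_imp_surj_on[OF leaves, symmetric])
  from bij_betw_combine[OF _ this, of "{c}" "{\<phi> c}"] show ?thesis
    using H.centre_not_in_branches by (simp add: G.pverts_eq H.pverts_eq)
qed

lemma two_level_tree_digraph_isoI:
  fixes G :: "'a pair_pre_digraph" and H :: "'b pair_pre_digraph"
  assumes "two_level_tree G c" "two_level_tree H (\<phi> c)"
    and leaves: "bij_betw \<phi> (nbrs G c) (nbrs H (\<phi> c))"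
    and pendants:
      "\<And>l. l \<in> nbrs G c \<Longrightarrow> bij_betw \<phi> (pendants G c l) (pendants H (\<phi> c) (\<phi> l))"
  shows "digraph_iso G H"
proof -
  interpret G: two_level_tree G c by fact
  interpret H: two_level_tree H "\<phi> c" by fact
  have leaf: "\<phi> l \<in> nbrs H (\<phi> c)" if "l \<in> nbrs G c" for l
    using leaves that by (rule bij_betwE[rule_format])
  have "bij_betw \<phi> (pverts G) (pverts H)"
    using assms by (rule two_level_tree_bij_betw_verts)
  moreover have "nbrs H (\<phi> v) = \<phi> ` nbrs G v" if "v \<in> pverts G" for v
    using that
  proof (cases rule: G.vert_cases)
    case centre
    then show ?thesis
      using bij_betw_imp_surj_on[OF leaves] by simp
  next
    case v: leaf
    show ?thesis
      using bij_betw_imp_surj_on[OF pendants[OF v]]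
      by (simp add: G.nbrs_leaf[OF v] H.nbrs_leaf[OF leaf[OF v]])
  next
    case (pendant l)
    then have "\<phi> v \<in> pendants H (\<phi> c) (\<phi> l)"
      using pendants bij_betwE by blast
    then show ?thesis
      by (simp add: G.nbrs_pendant[OF pendant] H.nbrs_pendant[OF leaf[OF pendant(1)]])
  qed
  ultimately show ?thesis
    unfolding digraph_iso_iff_nbrs[OF G.pair_wf_digraph H.pair_wf_digraph] by blast
qed

lemma two_level_tree_digraph_iso:
  fixes G :: "'a pair_pre_digraph" and H :: "'b pair_pre_digraph"
  assumes "two_level_tree G c" "two_level_tree H d"
    and leaves: "bij_betw \<beta> (nbrs G c) (nbrs H d)"
    and counts: "\<And>l. l \<in> nbrs G c \<Longrightarrow> card (pendants H d (\<beta> l)) = card (pendants G c l)"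
  shows "digraph_iso G H"
proof -
  interpret G: two_level_tree G c by fact
  interpret H: two_level_tree H d by fact
  have "\<exists>\<pi>. bij_betw \<pi> (pendants G c l) (pendants H d (\<beta> l))" if "l \<in> nbrs G c" for l
    using counts[OF that] by (intro finite_same_card_bij) simp_all
  then obtain \<pi> where
    \<pi>: "\<And>l. l \<in> nbrs G c \<Longrightarrow> bij_betw (\<pi> l) (pendants G c l) (pendants H d (\<beta> l))"
    by metis
  define \<phi> where "\<phi> v = (if v = c then d else if v \<in> nbrs G c then \<beta> v
    else \<pi> (the_elem (nbrs G v)) v)" for v
  have centre: "\<phi> c = d"
    by (simp add: \<phi>_def)
  have leaf: "\<phi> l = \<beta> l" if "l \<in> nbrs G c" for l
    using that G.leaf_neq_centre[OF that] by (simp add: \<phi>_def)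
  have pendant: "\<phi> q = \<pi> l q" if "l \<in> nbrs G c" "q \<in> pendants G c l" for l q
    using G.pendant_neq_centre[OF that(2)] G.pendant_not_leaf[OF that] G.nbrs_pendant[OF that]
    by (simp add: \<phi>_def)
  show ?thesis
  proof (rule two_level_tree_digraph_isoI[OF assms(1), of H \<phi>], unfold centre)
    show "two_level_tree H d" by fact
    show "bij_betw \<phi> (nbrs G c) (nbrs H d)"
      using leaves leaf by (subst bij_betw_cong)
    show "bij_betw \<phi> (pendants G c l) (pendants H d (\<phi> l))" if "l \<in> nbrs G c" for l
      unfolding leaf[OF that] using \<pi>[OF that] pendant[OF that] by (subst bij_betw_cong)
  qed
qed

lemma
  assumes "n \<ge> 1"
  shows two_level_tree_star_with_pendants: "two_level_tree (star_with_pendants n k) Centre"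
    and nbrs_Centre: "nbrs (star_with_pendants n k) Centre = Leaf ` {1..n}"
    and card_pendants_Leaf:
      "i \<in> {1..n} \<Longrightarrow> card (pendants (star_with_pendants n k) Centre (Leaf i)) = k i"
proof -
  let ?S = "star_with_pendants n k"
  interpret S: pair_graph ?S
    by (rule pair_graph_star_with_pendants)
  show leaves: "nbrs ?S Centre = Leaf ` {1..n}"
    by (auto simp: nbrs_def star_with_pendants_def star_def)
  have pendants: "pendants ?S Centre (Leaf i) = Pendant i ` {1..k i}" if "i \<in> {1..n}" for i
    using that by (auto simp: pendants_def nbrs_def star_with_pendants_def star_def)
  show "two_level_tree ?S Centre"
  proof
    have "(\<Union>l \<in> nbrs ?S Centre. insert l (pendants ?S Centre l)) =
        (\<Union>i \<in> {1..n}. insert (Leaf i) (Pendant i ` {1..k i}))"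
      by (simp add: leaves pendants)
    then show "pverts ?S = insert Centre (\<Union>l \<in> nbrs ?S Centre. insert l (pendants ?S Centre l))"
      by (auto simp: star_with_pendants_def star_def)
    show "nbrs ?S Centre \<noteq> {}"
      using assms by (simp add: leaves)
    show "nbrs ?S q = {l}" if "l \<in> nbrs ?S Centre" "q \<in> pendants ?S Centre l" for l q
      using that by (auto simp: leaves pendants)
        (auto simp: nbrs_def star_with_pendants_def star_def)
  qed
  show "card (pendants ?S Centre (Leaf i)) = k i" if "i \<in> {1..n}"
    using that by (simp add: pendants card_image inj_on_def)
qed

lemma ex_antimono_enumeration:
  fixes f :: "'a \<Rightarrow> 'b :: linorder"
  assumes "finite A"
  obtains e where "bij_betw e {1..card A} A" "antimono_on {1..card A} (f \<circ> e)"
proof -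
  obtain ys where ys: "set ys = A" "distinct ys"
    using finite_distinct_list[OF assms] by blast
  define xs where "xs = sort_key f ys"
  have xs: "set xs = A" "distinct xs" "sorted (map f xs)"
    using ys by (auto simp: xs_def)
  then have len: "length xs = card A"
    using distinct_card by force
  define e where "e = (!) xs \<circ> (\<lambda>i. card A - i)"
  have "bij_betw (\<lambda>i. card A - i) {1..card A} {..<card A}"
    by (rule bij_betw_byWitness[where f' = "\<lambda>i. card A - i"]) auto
  moreover have "bij_betw ((!) xs) {..<card A} A"
    using xs len by (intro bij_betw_nth) auto
  ultimately have "bij_betw e {1..card A} A"
    unfolding e_def by (rule bij_betw_trans)
  moreover have "antimono_on {1..card A} (f \<circ> e)"
    using sorted_nth_mono[OF xs(3)] len by (auto simp: monotone_on_def e_def)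
  ultimately show thesis
    using that by blast
qed

lemma two_level_tree_imp_star_with_pendants:
  assumes "two_level_tree G c"
  obtains n k where "n \<ge> 1" "antimono_on {1..n} k" "k ` {1..n} = pendant_counts G c"
    "digraph_iso G (star_with_pendants n k)"
proof -
  interpret two_level_tree G c by fact
  define n where "n = card (nbrs G c)"
  have n: "n \<ge> 1"
    using nbrs_centre_nonempty by (simp add: n_def Suc_le_eq card_gt_0_iff)
  obtain e where e: "bij_betw e {1..n} (nbrs G c)"
    and "antimono_on {1..n} ((\<lambda>l. card (pendants G c l)) \<circ> e)"
    using ex_antimono_enumeration[OF finite_nbrs] unfolding n_def by blast
  moreover define k where "k = (\<lambda>l. card (pendants G c l)) \<circ> e"
  moreover have "k ` {1..n} = pendant_counts G c"
    unfolding k_def pendant_counts_def bij_betw_imp_surj_on[OF e, symmetric]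
    by (rule image_comp[symmetric])
  moreover have "digraph_iso G (star_with_pendants n k)"
  proof (rule two_level_tree_digraph_iso[OF assms two_level_tree_star_with_pendants[OF n]])
    have e': "bij_betw (inv_into {1..n} e) (nbrs G c) {1..n}"
      using e by (rule bij_betw_inv_into)
    moreover have "bij_betw Leaf {1..n} (Leaf ` {1..n})"
      by (simp add: bij_betw_def inj_on_def)
    ultimately show "bij_betw (Leaf \<circ> inv_into {1..n} e) (nbrs G c)
        (nbrs (star_with_pendants n k) Centre)"
      unfolding nbrs_Centre[OF n] by (rule bij_betw_trans)
    fix l assume l: "l \<in> nbrs G c"
    then have "inv_into {1..n} e l \<in> {1..n}" "e (inv_into {1..n} e l) = l"
      using e e' by (auto simp: bij_betw_inv_into_right dest: bij_betwE)
    then show "card (pendants (star_with_pendants n k) Centre ((Leaf \<circ> inv_into {1..n} e) l)) =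
        card (pendants G c l)"
      by (simp add: card_pendants_Leaf[OF n] k_def)
  qed
  ultimately show thesis
    using that n by simp
qed

lemma star_with_pendants_imp_two_level_tree:
  assumes "pair_graph G" "n \<ge> 1" "digraph_iso G (star_with_pendants n k)"
  obtains c where "two_level_tree G c" "pendant_counts G c = k ` {1..n}"
proof -
  interpret G: pair_graph G by fact
  interpret S: two_level_tree "star_with_pendants n k" Centre
    using assms(2) by (rule two_level_tree_star_with_pendants)
  have "digraph_iso (star_with_pendants n k) G"
    using G.wf_digraph_axioms assms(3) by (rule digraph_iso_swap)
  then obtain \<phi> where "bij_betw \<phi> (pverts (star_with_pendants n k)) (pverts G)"
    "\<And>v. v \<in> pverts (star_with_pendants n k) \<Longrightarrow>
      nbrs G (\<phi> v) = \<phi> ` nbrs (star_with_pendants n k) v"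
    unfolding digraph_iso_iff_nbrs[OF S.pair_wf_digraph G.pair_wf_digraph] by blast
  note image = two_level_tree_image[OF S.two_level_tree_axioms assms(1) this]
  have "pendant_counts (star_with_pendants n k) Centre = k ` {1..n}"
    using card_pendants_Leaf[OF assms(2)]
    by (simp add: pendant_counts_def nbrs_Centre[OF assms(2)] image_image)
  with image show thesis
    using that by simp
qed


section \<open>Two-level trees are critical\<close>

context two_level_tree
begin

definition stems :: "'a set" where
  "stems = {l \<in> nbrs G c. pendants G c l \<noteq> {}}"

lemma stems_subset: "stems \<subseteq> nbrs G c"
  by (auto simp: stems_def)

lemma finite_stems [simp]: "finite stems"
  using stems_subset by (rule finite_subset) simp

definition stem_function :: "'a \<Rightarrow> nat" where
  "stem_function v = (if v = c then (if nbrs G c = stems then 1 else 2)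
     else if v \<in> stems then 2 else 0)"

lemma stem_function_centre: "stem_function c = (if nbrs G c = stems then 1 else 2)"
  by (simp add: stem_function_def)

lemma stem_function_leaf:
  "l \<in> nbrs G c \<Longrightarrow> stem_function l = (if l \<in> stems then 2 else 0)"
  using leaf_neq_centre by (simp add: stem_function_def)

lemma stem_function_pendant:
  assumes "l \<in> nbrs G c" "q \<in> pendants G c l"
  shows "stem_function q = 0"
  using stems_subset pendant_neq_centre[OF assms(2)] pendant_not_leaf[OF assms]
  by (auto simp: stem_function_def)

lemma trd_function_stem_function:
  assumes "stems \<noteq> {}"
  shows "trd_function G stem_function"
proof -
  have "\<exists>u. u \<in> defenders G stem_function v" if "v \<in> pverts G" for v
    using that
  proof (cases rule: vert_cases)
    case centre
    obtain l where "l \<in> stems"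
      using assms by blast
    then have "l \<in> defenders G stem_function c"
      using stems_subset by (auto simp: defenders_def stem_function_leaf stem_function_centre)
    with centre show ?thesis by blast
  next
    case leaf
    then have "c \<in> nbrs G v" "v \<notin> stems \<Longrightarrow> nbrs G c \<noteq> stems"
      using nbrs_sym by blast+
    then have "c \<in> defenders G stem_function v"
      by (simp add: defenders_def stem_function_leaf[OF leaf] stem_function_centre)
    then show ?thesis by blast
  next
    case (pendant l)
    then have "l \<in> stems"
      by (auto simp: stems_def)
    then have "l \<in> defenders G stem_function v"
      by (simp add: defenders_def nbrs_pendant[OF pendant] stem_function_pendant[OF pendant]
          stem_function_leaf[OF pendant(1)])
    then show ?thesis by blast
  qed
  then show ?thesis
    by (auto simp: trd_function_iff stem_function_def)
qed

lemma trd_weight_stem_function: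
  "trd_weight G stem_function = 2 * card stems + (if nbrs G c = stems then 1 else 2)"
proof -
  have "trd_weight G stem_function =
      stem_function c + (\<Sum>l \<in> nbrs G c. if l \<in> stems then 2 else 0)"
    by (simp add: trd_weight_eq branch_weight_def stem_function_leaf stem_function_pendant)
  also have "(\<Sum>l \<in> nbrs G c. if l \<in> stems then 2 else 0) = 2 * card stems"
    using stems_subset by (simp add: sum.If_cases Int_absorb1)
  finally show ?thesis
    by (simp add: stem_function_centre)
qed

lemma nbrs_del_edge_pendant:
  assumes "l \<in> nbrs G c" "m \<in> nbrs G c" "q \<in> pendants G c m"
  shows "nbrs (del_edge G c l) q = {m}"
proof -
  have "q \<noteq> c" "q \<noteq> l"
    using pendant_neq_centre[OF assms(3)] pendant_not_leaf[OF assms(2,3)] assms(1) by auto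
  then have "nbrs (del_edge G c l) q = nbrs G q"
    by (simp add: set_eq_iff in_nbrs_del_edge_iff)
  with nbrs_pendant[OF assms(2,3)] show ?thesis by simp
qed

lemma nbrs_del_edge_leaf:
  assumes "l \<in> nbrs G c"
  shows "nbrs (del_edge G c l) l = pendants G c l"
  using leaf_neq_centre[OF assms] by (auto simp: in_nbrs_del_edge_iff pendants_def)

context
  fixes l :: 'a and g :: "'a \<Rightarrow> nat"
  assumes leaf: "l \<in> nbrs G c" and trd_del: "trd_function (del_edge G c l) g"
begin

interpretation D: pair_graph "del_edge G c l"
  by (rule pair_graph_del_edge)

lemma branch_weight_stem_ge:
  assumes "m \<in> stems"
  shows "2 \<le> branch_weight g m"
proof -
  obtain q where m: "m \<in> nbrs G c" and q: "q \<in> pendants G c m"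
    using assms by (auto simp: stems_def)
  have "q \<in> pverts (del_edge G c l)"
    using subsetD[OF pendants_subset_verts q] by simp
  then have "2 \<le> g q + g m"
    using D.trd_function_pendant_ge[OF trd_del] nbrs_del_edge_pendant[OF leaf m q] by blast
  with branch_weight_ge[OF q, of g] show ?thesis by linarith
qed

lemma branch_weight_leaf_ge:
  assumes "2 \<le> card (pendants G c l)"
  shows "3 \<le> branch_weight g l"
  using D.trd_function_star_ge[OF trd_del, of l] in_nbrsD(1)[OF leaf] assms
    nbrs_del_edge_pendant[OF leaf leaf]
  by (simp add: nbrs_del_edge_leaf[OF leaf] branch_weight_def)

lemma ex_branch_weight_ge:
  assumes "g c = 0"
  obtains m where "m \<in> nbrs G c" "m \<noteq> l" "3 \<le> branch_weight g m"
proof -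
  obtain m where "m \<in> defenders (del_edge G c l) g c"
    using D.ex_defender[OF trd_del] centre_in_verts by auto
  then have m: "m \<in> nbrs G c" "m \<noteq> l" "g m = 2"
    using assms by (simp_all add: defenders_def in_nbrs_del_edge_iff)
  \<comment> \<open>The defender of \<open>m\<close> cannot be \<open>c\<close>, so it is a pendant vertex.\<close>
  obtain q where "q \<in> defenders (del_edge G c l) g m"
    using D.ex_defender[OF trd_del, of m] in_nbrsD(1)[OF m(1)] by auto
  then have "q \<in> nbrs G m" "g q > 0"
    using in_defendersD[of q "del_edge G c l" g m] by (simp_all add: in_nbrs_del_edge_iff)
  then have "q \<in> pendants G c m"
    using assms by (auto simp: pendants_def)
  from branch_weight_ge[OF this, of g] have "3 \<le> branch_weight g m"
    using m(3) \<open>g q > 0\<close> by linarith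
  with m(1,2) show thesis
    by (rule that)
qed

lemma sum_branch_weight_stems_ge:
  assumes "E \<subseteq> stems" and heavy: "\<And>m. m \<in> E \<Longrightarrow> 3 \<le> branch_weight g m"
  shows "2 * card stems + card E \<le> sum (branch_weight g) stems"
proof -
  have "(\<Sum>m \<in> stems. of_bool (m \<in> E)) = card E"
    using assms(1) by (simp add: Int_absorb1)
  then have "2 * card stems + card E = (\<Sum>m \<in> stems. 2 + of_bool (m \<in> E))"
    unfolding sum.distrib by simp
  also have "\<dots> \<le> sum (branch_weight g) stems"
    using branch_weight_stem_ge heavy by (intro sum_mono) (auto simp: eval_nat_numeral)
  finally show ?thesis .
qed

lemma trd_weight_stem_function_less:
  assumes "2 \<le> card (pendants G c l)"
  shows "trd_weight G stem_function < trd_weight G g"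
proof -
  have l_stem: "l \<in> stems"
    using leaf assms by (auto simp: stems_def)
  note heavy_l = branch_weight_leaf_ge[OF assms]
  have stems_ge: "2 * card stems + 1 \<le> sum (branch_weight g) stems"
    using sum_branch_weight_stems_ge[of "{l}"] heavy_l l_stem by simp
  have "2 * card stems + (if nbrs G c = stems then 1 else 2) < trd_weight G g"
  proof (cases "nbrs G c = stems")
    case all_stems: True
    show ?thesis
    proof (cases "g c = 0")
      case True
      then obtain m where "m \<in> nbrs G c" "m \<noteq> l" "3 \<le> branch_weight g m"
        by (rule ex_branch_weight_ge)
      then have "2 * card stems + card {l, m} \<le> sum (branch_weight g) stems"
        using heavy_l l_stem all_stems by (intro sum_branch_weight_stems_ge) auto
      then show ?thesis
        using \<open>m \<noteq> l\<close> by (simp add: trd_weight_eq all_stems)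
    next
      case False
      then show ?thesis
        using stems_ge by (simp add: trd_weight_eq all_stems)
    qed
  next
    case False
    then obtain m where m: "m \<in> nbrs G c" "m \<notin> stems"
      using stems_subset by blast
    then have "nbrs (del_edge G c l) m = {c}"
      using nbrs_leaf[OF m(1)] l_stem by (auto simp: stems_def in_nbrs_del_edge_iff)
    then have "2 \<le> g m + g c"
      using D.trd_function_pendant_ge[OF trd_del, of m] in_nbrsD(1)[OF m(1)] by simp
    moreover have "branch_weight g m + sum (branch_weight g) stems \<le>
        sum (branch_weight g) (nbrs G c)"
      using sum_mono2[of "nbrs G c" "insert m stems" "branch_weight g"] m stems_subset by simp
    ultimately show ?thesis
      using stems_ge False by (simp add: trd_weight_eq branch_weight_def)
  qed
  then show ?thesis
    by (simp only: trd_weight_stem_function)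
qed

end

lemma edge_at_centre:
  assumes "v \<in> nbrs G u" "nbrs G u \<noteq> {v}" "nbrs G v \<noteq> {u}"
  shows "u = c \<or> v = c"
  using in_nbrsD(2)[OF assms(1)]
proof (cases rule: vert_cases)
  case leaf
  then show ?thesis
    using assms nbrs_leaf[OF leaf] nbrs_pendant[OF leaf] by blast
next
  case (pendant l)
  then show ?thesis
    using assms nbrs_pendant[OF pendant] by simp
qed simp

lemma no_isolated_verts: "no_isolated_verts G"
  unfolding no_isolated_verts_iff
proof
  fix v assume "v \<in> pverts G"
  then show "nbrs G v \<noteq> {}"
    by (cases rule: vert_cases) (use nbrs_centre_nonempty nbrs_leaf nbrs_pendant in blast)+
qed

lemma gamma_tR_less_trd_weight_del_edge:
  assumes counts: "1 \<notin> pendant_counts G c" and l: "l \<in> nbrs G c"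
    and g: "trd_function (del_edge G c l) g"
  shows "gamma_tR G < trd_weight G g"
proof -
  interpret D: pair_graph "del_edge G c l"
    by (rule pair_graph_del_edge)
  have "nbrs (del_edge G c l) l \<noteq> {}"
    using D.trd_function_imp_no_isolated_verts[OF g] in_nbrsD(1)[OF l]
    by (simp add: D.no_isolated_verts_iff)
  then have "pendants G c l \<noteq> {}"
    by (simp add: nbrs_del_edge_leaf[OF l])
  then have "card (pendants G c l) \<noteq> 0" "l \<in> stems"
    using l by (auto simp: stems_def)
  moreover have "card (pendants G c l) \<in> pendant_counts G c"
    using l by (simp add: pendant_counts_def)
  then have "card (pendants G c l) \<noteq> 1"
    using counts by metis
  ultimately have "trd_weight G stem_function < trd_weight G g"
    by (intro trd_weight_stem_function_less[OF l g]) linarith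
  moreover have "gamma_tR G \<le> trd_weight G stem_function"
    using \<open>l \<in> stems\<close> by (intro gamma_tR_le trd_function_stem_function) blast
  ultimately show ?thesis by linarith
qed

lemma gamma_tR_ER_critical:
  assumes "1 \<notin> pendant_counts G c"
  shows "gamma_tR_ER_critical G"
  unfolding gamma_tR_ER_critical_iff[OF no_isolated_verts]
proof (intro allI ballI impI)
  fix u v g assume v: "v \<in> nbrs G u" and g: "trd_function (del_edge G u v) g"
  interpret D: pair_graph "del_edge G u v"
    by (rule pair_graph_del_edge)
  have "nbrs (del_edge G u v) u \<noteq> {}" "nbrs (del_edge G u v) v \<noteq> {}"
    using D.trd_function_imp_no_isolated_verts[OF g] in_nbrsD[OF v]
    by (simp_all add: D.no_isolated_verts_iff)
  then have "nbrs G u \<noteq> {v}" "nbrs G v \<noteq> {u}"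
    by (auto simp: in_nbrs_del_edge_iff)
  then consider (tail) "u = c" | (head) "v = c"
    using edge_at_centre[OF v] by blast
  then show "gamma_tR G < trd_weight G g"
  proof cases
    case tail
    then show ?thesis
      using gamma_tR_less_trd_weight_del_edge[OF assms] v g by simp
  next
    case head
    then have "u \<in> nbrs G c" "trd_function (del_edge G c u) g"
      using v g nbrs_sym by (simp_all add: del_edge_commute)
    then show ?thesis
      by (rule gamma_tR_less_trd_weight_del_edge[OF assms])
  qed
qed

end


section \<open>Critical graphs are two-level trees\<close>

lemma (in pair_graph) not_trd_del_edge_imp_sole_defender:
  assumes f: "trd_function G f" and v: "v \<in> nbrs G u"
    and "\<not> trd_function (del_edge G u v) f"
  shows "defenders G f u = {v} \<or> defenders G f v = {u}"
proof -
  interpret D: pair_graph "del_edge G u v"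
    by (rule pair_graph_del_edge)
  obtain x where "x \<in> pverts G" and x: "defenders (del_edge G u v) f x = {}"
    using f assms(3) by (auto simp: trd_function_iff D.trd_function_iff)
  then obtain y where "y \<in> defenders G f x"
    using ex_defender[OF f] by blast
  moreover have "(x, z) = (u, v) \<or> (x, z) = (v, u)" if "z \<in> defenders G f x" for z
    using that x by (auto simp: defenders_def in_nbrs_del_edge_iff)
  ultimately have "defenders G f x = {y}" "(x, y) = (u, v) \<or> (x, y) = (v, u)"
    using not_in_nbrs_self v by blast+
  then show ?thesis by blast
qed

lemma (in pair_graph) connected_two_level_treeI:
  assumes "connected G" and c: "c \<in> pverts G" and "nbrs G c \<noteq> {}"
    and pendant: "\<And>l q. \<lbrakk>l \<in> nbrs G c; q \<in> pendants G c l\<rbrakk> \<Longrightarrow> nbrs G q = {l}"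
  shows "two_level_tree G c"
proof -
  let ?T = "insert c (\<Union>l \<in> nbrs G c. insert l (pendants G c l))"
  have "nbrs G v \<subseteq> ?T" if v: "v \<in> ?T" for v
  proof -
    consider "v = c" | "v \<in> nbrs G c" | (pendant) l where "l \<in> nbrs G c" "v \<in> pendants G c l"
      using v by blast
    then show ?thesis
    proof cases
      case (pendant l)
      then show ?thesis
        using assms(4)[OF pendant] by blast
    qed (auto simp: pendants_def)
  qed
  then have "pverts G \<subseteq> ?T"
    by (rule connected_verts_subset_closed[OF assms(1) c insertI1])
  moreover have "?T \<subseteq> pverts G"
    using c nbrs_subset_verts by (auto simp: pendants_def)
  ultimately show ?thesis
    using assms(3) pendant by unfold_locales auto
qed

locale edge_tight_trd = pair_graph G for G :: "'a pair_pre_digraph" +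
  fixes f :: "'a \<Rightarrow> nat"
  assumes trd: "trd_function G f"
    and edge_tight: "v \<in> nbrs G u \<Longrightarrow> \<not> trd_function (del_edge G u v) f"
begin

lemma nbrs_zero:
  assumes "v \<in> pverts G" "f v = 0"
  obtains w where "nbrs G v = {w}" "f w = 2"
proof -
  obtain w where w: "w \<in> defenders G f v"
    using ex_defender[OF trd assms(1)] by blast
  have "x = w" if "x \<in> nbrs G v" for x
  proof -
    have "v \<notin> defenders G f x"
      using in_defendersD(2)[of v G f x] assms(2) by auto
    then have "defenders G f v = {x}"
      using not_trd_del_edge_imp_sole_defender[OF trd that edge_tight[OF that]] by blast
    with w show ?thesis by simp
  qed
  moreover have "w \<in> nbrs G v" "f w = 2"
    using w assms(2) by (simp_all add: defenders_def)
  ultimately show thesis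
    using that by blast
qed

lemma ex_centre:
  assumes "pverts G \<noteq> {}"
  obtains c where "c \<in> pverts G" "f c > 0"
    "\<And>l q. \<lbrakk>l \<in> nbrs G c; q \<in> pendants G c l\<rbrakk> \<Longrightarrow> f q = 0"
proof -
  \<comment> \<open>The centre is a positive vertex with as many defenders as possible: if a neighbour of the
    centre had two defenders, then so would the centre, and their edge would be superfluous.\<close>
  define positive where "positive = {v \<in> pverts G. f v > 0}"
  have "finite positive"
    using pair_finite_verts by (simp add: positive_def)
  moreover have "positive \<noteq> {}"
    using trd_function_imp_ex_positive[OF trd assms] by (auto simp: positive_def)
  ultimately obtain c where "c \<in> positive"
    and max: "Max ((\<lambda>v. card (defenders G f v)) ` positive) = card (defenders G f c)"
    by (rule obtains_MAX)
  then have c: "c \<in> pverts G" "f c > 0"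
    by (simp_all add: positive_def)
  have "f q = 0" if l: "l \<in> nbrs G c" and q: "q \<in> pendants G c l" for l q
  proof (rule ccontr)
    assume "f q \<noteq> 0"
    have "c \<in> nbrs G l" "q \<in> nbrs G l" "q \<noteq> c"
      using l q nbrs_sym by (auto simp: pendants_def)
    then have "f l > 0"
      using nbrs_zero[OF in_nbrsD(1)[OF l]] by (metis gr0I singletonD)
    have two: "{c, q} \<subseteq> defenders G f l"
      using c(2) \<open>f q \<noteq> 0\<close> \<open>f l > 0\<close> \<open>c \<in> nbrs G l\<close> \<open>q \<in> nbrs G l\<close>
      by (simp add: defenders_def)
    then have "2 \<le> card (defenders G f l)"
      using card_mono[OF finite_defenders two] \<open>q \<noteq> c\<close> by simp
    also have "\<dots> \<le> card (defenders G f c)"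
      unfolding max[symmetric] using \<open>finite positive\<close> \<open>f l > 0\<close> in_nbrsD(1)[OF l]
      by (intro Max_ge) (auto simp: positive_def)
    finally have "defenders G f c \<noteq> {l}"
      by auto
    moreover have "defenders G f l \<noteq> {c}"
      using two \<open>q \<noteq> c\<close> by blast
    ultimately show False
      using not_trd_del_edge_imp_sole_defender[OF trd l edge_tight[OF l]] by blast
  qed
  with c show thesis
    by (rule that)
qed

lemma connected_imp_two_level_tree:
  assumes "connected G"
  obtains c where "two_level_tree G c" "f c > 0"
    "\<And>l q. \<lbrakk>l \<in> nbrs G c; q \<in> pendants G c l\<rbrakk> \<Longrightarrow> f q = 0"
proof -
  have "pverts G \<noteq> {}"
    using assms by (auto simp: connected_def strongly_connected_def)
  then obtain c where c: "c \<in> pverts G" "f c > 0"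
    and zero: "\<And>l q. \<lbrakk>l \<in> nbrs G c; q \<in> pendants G c l\<rbrakk> \<Longrightarrow> f q = 0"
    using ex_centre by blast
  have pendant: "nbrs G q = {l}" if "l \<in> nbrs G c" "q \<in> pendants G c l" for l q
  proof -
    have "q \<in> nbrs G l"
      using that(2) by (simp add: pendants_def)
    then have "q \<in> pverts G" "l \<in> nbrs G q"
      using in_nbrsD(1) nbrs_sym by blast+
    then show ?thesis
      using nbrs_zero zero[OF that] by (metis singletonD)
  qed
  have "nbrs G c \<noteq> {}"
    using trd c(1) by (auto simp: trd_function_iff defenders_def)
  then have "two_level_tree G c"
    using connected_two_level_treeI[OF assms c(1)] pendant by blast
  then show thesis
    using c(2) zero by (rule that)
qed

end

definition zeros :: "'a pair_pre_digraph \<Rightarrow> ('a \<Rightarrow> nat) \<Rightarrow> 'a set" where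
  "zeros G f = {v \<in> pverts G. f v = 0}"

lemma (in pair_fin_digraph) trd_weight_fun_upd:
  assumes "v \<in> pverts G"
  shows "trd_weight G (f(v := a)) + f v = trd_weight G f + a"
proof -
  have "sum (f(v := a)) (pverts G - {v}) = sum f (pverts G - {v})"
    by (intro sum.cong) auto
  then show ?thesis
    using assms pair_finite_verts by (simp add: trd_weight_def sum.remove[of _ v])
qed

lemma (in pair_graph) trd_function_fun_upd_1_1:
  assumes f: "trd_function G f" and zero_nbrs: "nbrs G l \<inter> zeros G f = {p}"
  shows "trd_function G (f(l := 1, p := 1))"
proof -
  let ?g = "f(l := 1, p := 1)"
  have p: "p \<in> nbrs G l" and p_zero: "f p = 0"
    using zero_nbrs by (auto simp: zeros_def)
  then have l: "l \<in> nbrs G p" "l \<noteq> p"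
    using nbrs_sym not_in_nbrs_self by auto
  have "\<exists>u. u \<in> defenders G ?g v" if v: "v \<in> pverts G" for v
  proof -
    consider (leaf) "v = l" | (pendant) "v = p" | (other) "v \<noteq> l" "v \<noteq> p"
      by blast
    then show ?thesis
    proof cases
      case leaf
      then have "p \<in> defenders G ?g v"
        using p by (simp add: defenders_def)
      then show ?thesis by blast
    next
      case pendant
      then have "l \<in> defenders G ?g v"
        using l by (simp add: defenders_def)
      then show ?thesis by blast
    next
      case other
      obtain u where u: "u \<in> defenders G f v"
        using ex_defender[OF f v] by blast
      have "u \<noteq> l" if "f v = 0"
        using that v in_defendersD(1)[OF u] nbrs_sym zero_nbrs other(2) by (auto simp: zeros_def)
      then have "u \<in> defenders G ?g v"
        using u p_zero other by (auto simp: defenders_def split: if_splits)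
      then show ?thesis by blast
    qed
  qed
  then show ?thesis
    using f by (auto simp: trd_function_iff)
qed

lemma (in pair_graph) ex_trd_function_fewer_zeros:
  assumes "trd_function G f" "l \<in> pverts G" "f l = 2"
    and zero_nbrs: "nbrs G l \<inter> zeros G f = {p}"
  obtains g where "trd_function G g" "trd_weight G g = trd_weight G f"
    "card (zeros G g) < card (zeros G f)"
proof -
  let ?g = "f(l := 1, p := 1)"
  have p: "p \<in> pverts G" "p \<noteq> l" "f p = 0"
    using zero_nbrs assms(3) by (auto simp: zeros_def)
  have "trd_function G ?g"
    using assms(1) zero_nbrs by (rule trd_function_fun_upd_1_1)
  moreover have "trd_weight G ?g = trd_weight G f"
    using trd_weight_fun_upd[OF p(1), of "f(l := 1)" 1] trd_weight_fun_upd[OF assms(2), of f 1]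
      assms(3) p(2,3) by simp
  moreover have "zeros G ?g \<subset> zeros G f"
    using p by (auto simp: zeros_def split: if_splits)
  then have "card (zeros G ?g) < card (zeros G f)"
    using pair_finite_verts by (intro psubset_card_mono) (simp_all add: zeros_def)
  ultimately show thesis
    by (rule that)
qed

lemma (in pair_fin_digraph) gamma_tR_attained_fewest_zeros:
  assumes "no_isolated_verts G"
  obtains f where "trd_function G f" "trd_weight G f = gamma_tR G"
    "\<And>g. \<lbrakk>trd_function G g; trd_weight G g = gamma_tR G\<rbrakk> \<Longrightarrow> card (zeros G f) \<le> card (zeros G g)"
proof -
  obtain f where "trd_function G f \<and> trd_weight G f = gamma_tR G"
    using gamma_tR_attained[OF assms] by blast
  from ex_has_least_nat[of "\<lambda>f. trd_function G f \<and> trd_weight G f = gamma_tR G", OF this,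
      of "\<lambda>f. card (zeros G f)"]
  show thesis
    using that by blast
qed

lemma (in pair_graph) critical_imp_edge_tight_trd:
  assumes "gamma_tR_ER_critical G" "trd_function G f" "trd_weight G f = gamma_tR G"
  shows "edge_tight_trd G f"
proof
  have "no_isolated_verts G"
    using assms(1) by (simp add: gamma_tR_ER_critical_def)
  then show "\<not> trd_function (del_edge G u v) f" if "v \<in> nbrs G u" for u v
    using assms(1,3) that gamma_tR_ER_critical_iff by (metis less_irrefl)
qed fact

lemma (in pair_graph) critical_imp_two_level_tree:
  assumes "connected G" "gamma_tR_ER_critical G"
  obtains c where "two_level_tree G c" "1 \<notin> pendant_counts G c"
proof -
  have "no_isolated_verts G"
    using assms(2) by (simp add: gamma_tR_ER_critical_def)
  then obtain f where f: "trd_function G f" "trd_weight G f = gamma_tR G"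
    and fewest_zeros: "\<And>g. \<lbrakk>trd_function G g; trd_weight G g = gamma_tR G\<rbrakk> \<Longrightarrow>
      card (zeros G f) \<le> card (zeros G g)"
    by (rule gamma_tR_attained_fewest_zeros) blast
  interpret edge_tight_trd G f
    using assms(2) f by (rule critical_imp_edge_tight_trd)
  obtain c where "two_level_tree G c" and c: "f c > 0"
    and zero: "\<And>l q. \<lbrakk>l \<in> nbrs G c; q \<in> pendants G c l\<rbrakk> \<Longrightarrow> f q = 0"
    using assms(1) by (rule connected_imp_two_level_tree) blast
  then interpret two_level_tree G c by blast
  have "card (pendants G c l) \<noteq> 1" if l: "l \<in> nbrs G c" for l
  proof
    assume "card (pendants G c l) = 1"
    then obtain p where p: "pendants G c l = {p}"
      by (rule card_1_singletonE)
    then have p_verts: "p \<in> pverts G" and "f p = 0" and "nbrs G p = {l}"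
      using pendants_subset_verts[of l] zero[OF l] nbrs_pendant[OF l] by auto
    then have "f l = 2"
      using nbrs_zero[of p] by (metis singleton_inject)
    moreover have "nbrs G l \<inter> zeros G f = {p}"
      using c \<open>f p = 0\<close> p_verts nbrs_leaf[OF l] by (auto simp: p zeros_def)
    ultimately obtain g where "trd_function G g" "trd_weight G g = trd_weight G f"
      "card (zeros G g) < card (zeros G f)"
      by (rule ex_trd_function_fewer_zeros[OF f(1) in_nbrsD(1)[OF l]])
    with fewest_zeros[of g] f(2) show False by simp
  qed
  then have "1 \<notin> pendant_counts G c"
    unfolding pendant_counts_def by (metis imageE)
  with \<open>two_level_tree G c\<close> show thesis
    by (rule that)
qed

theorem theorem7p11:
  fixes G :: "'a pair_pre_digraph"
  assumes "pair_graph G"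
    and "connected G"
    and "no_isolated_verts G"
  shows "gamma_tR_ER_critical G \<longleftrightarrow>
    (\<exists>(n::nat) (k :: nat \<Rightarrow> nat). n \<ge> 1 \<and>
       (\<forall>i \<in> {1..n}. \<forall>j \<in> {1..n}. i \<le> j \<longrightarrow> k i \<ge> k j) \<and>
       (\<forall>i \<in> {1..n}. k i \<noteq> 1) \<and>
       digraph_iso G (star_with_pendants n k))"
    (is "_ \<longleftrightarrow> (\<exists>n k. ?star n k)")
proof
  assume "gamma_tR_ER_critical G"
  then obtain c where tree: "two_level_tree G c" and counts: "1 \<notin> pendant_counts G c"
    by (rule pair_graph.critical_imp_two_level_tree[OF assms(1,2)])
  obtain n k where "n \<ge> 1" "antimono_on {1..n} k" "k ` {1..n} = pendant_counts G c"
    "digraph_iso G (star_with_pendants n k)"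
    using tree by (rule two_level_tree_imp_star_with_pendants)
  moreover from this(3) counts have "\<forall>i \<in> {1..n}. k i \<noteq> 1"
    by (metis imageI)
  ultimately have "?star n k"
    by (simp add: monotone_on_def)
  then show "\<exists>n k. ?star n k" by blast
next
  assume "\<exists>n k. ?star n k"
  then obtain n k where star: "n \<ge> 1" "\<forall>i \<in> {1..n}. k i \<noteq> 1"
    "digraph_iso G (star_with_pendants n k)"
    by blast
  obtain c where "two_level_tree G c" "pendant_counts G c = k ` {1..n}"
    using assms(1) star(1,3) by (rule star_with_pendants_imp_two_level_tree)
  moreover from this star(2) have "1 \<notin> pendant_counts G c"
    by auto
  ultimately show "gamma_tR_ER_critical G"
    by (intro two_level_tree.gamma_tR_ER_critical)
qed

end
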